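(* Let $G$ be a finite connected multigraph (loops and parallel edges permitted) with i.i.d. edge weights of an atomless law, let $T$ be the almost surely unique minimum spanning tree, and let $e\ne f$ be distinct edges of $G$. Write $p_e=\mathbf{P}(e\in T)$, $p_f=\mathbf{P}(f\in T)$, $p_{ef}=\mathbf{P}(e\in T,\ f\in T)$, and put $g(p)=\frac{1-\sqrt{1-4p}}{2}$ for $0\le p\le\frac14$. If $p_e,p_f\le\frac14$, then $$p_{ef}\le 2\,g(p_e)\,g(p_f).$$ If in addition $p_ep_f>0$, then $$\frac{p_{ef}}{p_ep_f}\le 2\,\frac{g(p_e)}{p_e}\,\frac{g(p_f)}{p_f}.$$ Consequently the upper bound on the ratio $p_{ef}/(p_ep_f)$ is $2+o(1)$ as $\max(p_e,p_f)\to0$ (uniformly over all such $G,e,f$ with $p_ep_f>0$).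
   Context: Since the common law is atomless, the edge weights are almost surely distinct and the minimum spanning tree is almost surely unique. *)

theory Defs
  imports "HOL-Probability.Probability" "HOL-Library.Uprod"
begin

text \<open>
  A multigraph is given by a vertex set \<open>V\<close>, an edge set \<open>E\<close> and the map \<open>ends\<close> that sends an
  edge to the unordered pair of its endpoints; \<open>Upair v v\<close> is the endpoint pair of a loop, and
  different edges may have the same endpoints.
\<close>

locale finite_multigraph =
  fixes V :: "'v set" and E :: "'e set" and ends :: "'e \<Rightarrow> 'v uprod"
  assumes finite_verts: "finite V"
    and finite_edges: "finite E"
    and ends_in_verts: "\<And>e. e \<in> E \<Longrightarrow> set_uprod (ends e) \<subseteq> V"

text \<open>
  \<open>walk ends F u p v\<close>: starting at \<open>u\<close>, the list \<open>p\<close> of steps (edge used, vertex reached) is a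
  walk to \<open>v\<close> using only edges of \<open>F\<close>.
\<close>

fun walk :: "('e \<Rightarrow> 'v uprod) \<Rightarrow> 'e set \<Rightarrow> 'v \<Rightarrow> ('e \<times> 'v) list \<Rightarrow> 'v \<Rightarrow> bool" where
  "walk ends F u [] v \<longleftrightarrow> u = v"
| "walk ends F u ((e, x) # p) v \<longleftrightarrow> e \<in> F \<and> ends e = Upair u x \<and> walk ends F x p v"

definition mg_connected :: "'v set \<Rightarrow> 'e set \<Rightarrow> ('e \<Rightarrow> 'v uprod) \<Rightarrow> bool" where
  "mg_connected V F ends \<longleftrightarrow> V \<noteq> {} \<and> (\<forall>u\<in>V. \<forall>v\<in>V. \<exists>p. walk ends F u p v)"

text \<open>
  In a cycle neither edges nor vertices repeat. Loops are cycles of length 1 and two parallel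
  edges form a cycle of length 2; distinctness of the edges excludes traversing one edge back
  and forth.
\<close>

definition mg_cycle :: "('e \<Rightarrow> 'v uprod) \<Rightarrow> 'e set \<Rightarrow> 'v \<Rightarrow> ('e \<times> 'v) list \<Rightarrow> bool" where
  "mg_cycle ends F u p \<longleftrightarrow>
     p \<noteq> [] \<and> walk ends F u p u \<and> distinct (map fst p) \<and> distinct (map snd p)"

definition spanning_tree :: "'v set \<Rightarrow> 'e set \<Rightarrow> ('e \<Rightarrow> 'v uprod) \<Rightarrow> 'e set \<Rightarrow> bool" where
  "spanning_tree V E ends T \<longleftrightarrow>
     T \<subseteq> E \<and> mg_connected V T ends \<and> (\<nexists>u p. mg_cycle ends T u p)"

definition is_mst :: "'v set \<Rightarrow> 'e set \<Rightarrow> ('e \<Rightarrow> 'v uprod) \<Rightarrow> ('e \<Rightarrow> real) \<Rightarrow> 'e set \<Rightarrow> bool" where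
  "is_mst V E ends w T \<longleftrightarrow>
     spanning_tree V E ends T \<and>
     (\<forall>T'. spanning_tree V E ends T' \<longrightarrow> (\<Sum>e\<in>T. w e) \<le> (\<Sum>e\<in>T'. w e))"

text \<open>
  The minimum spanning tree for random weights \<open>W\<close> at the outcome \<open>\<omega>\<close>. Its value is unspecified
  where the minimum spanning tree is not unique; for independent weights with an atomless law this
  happens only on a null set.
\<close>

definition random_mst ::
  "'v set \<Rightarrow> 'e set \<Rightarrow> ('e \<Rightarrow> 'v uprod) \<Rightarrow> ('e \<Rightarrow> 'w \<Rightarrow> real) \<Rightarrow> 'w \<Rightarrow> 'e set" where
  "random_mst V E ends W \<omega> = (THE T. is_mst V E ends (\<lambda>e. W e \<omega>) T)"

locale iid_weighted_multigraph = finite_multigraph V E ends + prob_space M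
  for V :: "'v set" and E :: "'e set" and ends :: "'e \<Rightarrow> 'v uprod" and M :: "'w measure" +
  fixes L :: "real measure" and W :: "'e \<Rightarrow> 'w \<Rightarrow> real"
  assumes connected: "mg_connected V E ends"
    and indep: "indep_vars (\<lambda>_. borel) W E"
    and law: "\<And>e. e \<in> E \<Longrightarrow> distr M borel (W e) = L"
    and atomless: "\<And>x. measure L {x} = 0"

text \<open>Only the values for \<open>0 \<le> p \<le> 1/4\<close> are meant.\<close>

definition g :: "real \<Rightarrow> real" where
  "g p = (1 - sqrt (1 - 4 * p)) / 2"

end

theory Submission imports Defs "HOL-Combinatorics.Permutations" "HOL-Real_Asymp.Real_Asymp" begin

text \<open>
  Since \<open>p \<le> g p\<close>, it suffices to show \<open>p\<^sub>e\<^sub>f \<le> 2 p\<^sub>e p\<^sub>f\<close>. For distinct weights,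
  an edge belongs to the minimum spanning tree iff its endpoints are not connected by strictly lighter edges. Suppose that \<open>e\<close> is lighter
  than \<open>f\<close> and both are in the tree, and let \<open>S\<close> be the set of edges lighter than \<open>e\<close>. Given
  \<open>S\<close>, the edges heavier than \<open>e\<close> are in uniformly random order, and \<open>f\<close> must not be spanned
  by \<open>e\<close>, \<open>S\<close> and those of them that precede \<open>f\<close>. Replacing \<open>S\<close> by its subset of edges lighter
  than \<open>f\<close> in an independent order makes this event more likely, and it still implies that \<open>f\<close> is
  in the tree, so its conditional probability is at most \<open>p\<^sub>f\<close>. Summing over the sets \<open>S\<close> that do
  not span \<open>e\<close> gives \<open>p\<^sub>e p\<^sub>f\<close>, and the two orders of \<open>e\<close> and \<open>f\<close> give the factor 2.
\<close>

section \<open>Spanning by edge sets\<close>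

text \<open>Reachability by edges of \<open>F\<close> becomes \<open>(adj ends F)\<^sup>*\<close>,
  so that the induction rules for \<open>rtrancl\<close> replace arguments about walks.\<close>

definition adj :: "('e \<Rightarrow> 'v uprod) \<Rightarrow> 'e set \<Rightarrow> ('v \<times> 'v) set" where
  "adj ends F = {(u, v). \<exists>h\<in>F. ends h = Upair u v}"

text \<open>The closure operator of the cycle matroid.\<close>

definition spans :: "('e \<Rightarrow> 'v uprod) \<Rightarrow> 'e set \<Rightarrow> 'e \<Rightarrow> bool" where
  "spans ends F h \<longleftrightarrow> (\<forall>u v. ends h = Upair u v \<longrightarrow> (u, v) \<in> (adj ends F)\<^sup>*)"

lemma adj_rtrancl_sym:
  assumes "(u, v) \<in> (adj ends F)\<^sup>*"
  shows "(v, u) \<in> (adj ends F)\<^sup>*"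
proof -
  have "sym (adj ends F)"
  proof (rule symI)
    fix x y assume "(x, y) \<in> adj ends F"
    then obtain h where "h \<in> F" "ends h = Upair x y" by (auto simp: adj_def)
    moreover have "Upair x y = Upair y x" by simp
    ultimately show "(y, x) \<in> adj ends F" unfolding adj_def by auto
  qed
  then show ?thesis
    using assms by (meson sym_rtrancl symD)
qed

lemma adj_rtrancl_mono: "F \<subseteq> G \<Longrightarrow> (u, v) \<in> (adj ends F)\<^sup>* \<Longrightarrow> (u, v) \<in> (adj ends G)\<^sup>*"
  by (rule subsetD[OF rtrancl_mono]) (auto simp: adj_def)

lemma spans_Upair:
  assumes "ends h = Upair u v"
  shows "spans ends F h \<longleftrightarrow> (u, v) \<in> (adj ends F)\<^sup>*"
  using assms adj_rtrancl_sym[of _ _ ends F] by (auto simp: spans_def)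

lemma spans_mono: "F \<subseteq> G \<Longrightarrow> spans ends F h \<Longrightarrow> spans ends G h"
  by (meson adj_rtrancl_mono spans_def)

lemma spans_self: "h \<in> F \<Longrightarrow> spans ends F h"
  by (auto simp: spans_def adj_def)

lemma adj_rtrancl_spans:
  assumes "(u, v) \<in> (adj ends F)\<^sup>*" and "\<And>k. k \<in> F \<Longrightarrow> spans ends G k"
  shows "(u, v) \<in> (adj ends G)\<^sup>*"
  using assms(1)
proof (induction rule: rtrancl_induct)
  case (step y z)
  then obtain k where "k \<in> F" "ends k = Upair y z" by (auto simp: adj_def)
  then have "(y, z) \<in> (adj ends G)\<^sup>*" using assms(2) by (auto simp: spans_def)
  with step.IH show ?case by (rule rtrancl_trans)
qed simp

lemma spans_trans:
  assumes "spans ends F h" and "\<And>k. k \<in> F \<Longrightarrow> spans ends G k"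
  shows "spans ends G h"
  using assms adj_rtrancl_spans[of _ _ ends F G] by (auto simp: spans_def)

text \<open>Two passages of \<open>k\<close> can be shortened to at most one, so a connection that
  needs \<open>k\<close> uses it once, in one of its two directions.\<close>

lemma adj_rtrancl_insert:
  assumes k: "ends k = Upair a b" and "(u, v) \<in> (adj ends (insert k F))\<^sup>*"
  shows "(u, v) \<in> (adj ends F)\<^sup>*
    \<or> (u, a) \<in> (adj ends F)\<^sup>* \<and> (b, v) \<in> (adj ends F)\<^sup>*
    \<or> (u, b) \<in> (adj ends F)\<^sup>* \<and> (a, v) \<in> (adj ends F)\<^sup>*"
  using assms(2)
proof (induction rule: rtrancl_induct)
  case (step y z)
  let ?R = "(adj ends F)\<^sup>*"
  from step(2) consider "(y, z) \<in> ?R" | "y = a" "z = b" | "y = b" "z = a"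
    using k by (auto simp: adj_def)
  then show ?case
  proof cases
    case 1
    then show ?thesis using step.IH rtrancl_trans[of _ y "adj ends F" z] by blast
  next
    case 2
    then show ?thesis using step.IH by (auto intro: rtrancl.rtrancl_refl)
  next
    case 3
    then show ?thesis using step.IH by (auto intro: rtrancl.rtrancl_refl)
  qed
qed simp

text \<open>The exchange property of the cycle matroid: the path joining the ends of
  \<open>h\<close> must pass through \<open>k\<close>, and its two remaining pieces together with
  \<open>h\<close> join the ends of \<open>k\<close>.\<close>

lemma spans_exchange:
  assumes "spans ends (insert k F) h" "\<not> spans ends F h"
  shows "spans ends (insert h F) k"
proof -
  obtain a b where k: "ends k = Upair a b" by (cases "ends k")
  obtain u v where h: "ends h = Upair u v" by (cases "ends h")
  let ?G = "insert h F"
  have uv: "(u, v) \<in> (adj ends ?G)\<^sup>*"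
    using spans_self[of h ?G ends] by (simp add: spans_Upair[of ends h, OF h])
  from assms have "(u, a) \<in> (adj ends F)\<^sup>* \<and> (b, v) \<in> (adj ends F)\<^sup>*
    \<or> (u, b) \<in> (adj ends F)\<^sup>* \<and> (a, v) \<in> (adj ends F)\<^sup>*"
    using adj_rtrancl_insert[of ends, OF k, of u v F] by (simp add: spans_Upair[of ends h, OF h])
  then have "(u, a) \<in> (adj ends ?G)\<^sup>* \<and> (b, v) \<in> (adj ends ?G)\<^sup>*
    \<or> (u, b) \<in> (adj ends ?G)\<^sup>* \<and> (a, v) \<in> (adj ends ?G)\<^sup>*"
    using adj_rtrancl_mono[of F ?G _ _ ends] by blast
  then have "(a, b) \<in> (adj ends ?G)\<^sup>*"
  proof (elim disjE)
    assume "(u, a) \<in> (adj ends ?G)\<^sup>* \<and> (b, v) \<in> (adj ends ?G)\<^sup>*"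
    then have "(a, u) \<in> (adj ends ?G)\<^sup>*" "(v, b) \<in> (adj ends ?G)\<^sup>*"
      by (simp_all add: adj_rtrancl_sym)
    with uv show ?thesis by (blast intro: rtrancl_trans)
  next
    assume "(u, b) \<in> (adj ends ?G)\<^sup>* \<and> (a, v) \<in> (adj ends ?G)\<^sup>*"
    then show ?thesis using adj_rtrancl_sym[OF uv] by (blast intro: rtrancl_trans)
  qed
  then show ?thesis by (simp add: spans_Upair[of ends k, OF k])
qed

section \<open>Walks, paths and cycles in terms of spanning\<close>

lemma walk_imp_adj_rtrancl: "walk ends F u p v \<Longrightarrow> (u, v) \<in> (adj ends F)\<^sup>*"
proof (induction ends F u p v rule: walk.induct)
  case (2 ends F u e x p v)
  then have "(u, x) \<in> adj ends F" "(x, v) \<in> (adj ends F)\<^sup>*" by (auto simp: adj_def)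
  then show ?case by (rule converse_rtrancl_into_rtrancl)
qed simp

lemma walk_mono: "walk ends F u p v \<Longrightarrow> fst ` set p \<subseteq> G \<Longrightarrow> walk ends G u p v"
  by (induction ends F u p v rule: walk.induct) auto

lemma walk_edges: "walk ends F u p v \<Longrightarrow> fst ` set p \<subseteq> F"
  by (induction ends F u p v rule: walk.induct) auto

lemma walk_ends:
  "walk ends F u p v \<Longrightarrow> k \<in> fst ` set p \<Longrightarrow> set_uprod (ends k) \<subseteq> set (u # map snd p)"
  by (induction ends F u p v rule: walk.induct) auto

text \<open>In \<open>path_exists\<close> this removes the detour that arises when a new first
  vertex already lies on the path.\<close>

lemma walk_suffix:
  "walk ends F u p v \<Longrightarrow> distinct (u # map snd p) \<Longrightarrow> x \<in> set (u # map snd p) \<Longrightarrow>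
    \<exists>q. walk ends F x q v \<and> distinct (x # map snd q)"
proof (induction ends F u p v rule: walk.induct)
  case (2 ends F u e y p v)
  show ?case
  proof (cases "x = u")
    case True
    with 2 show ?thesis by blast
  next
    case False
    with 2 show ?thesis by auto
  qed
qed (auto intro: exI[of _ "[]"])

lemma path_exists:
  assumes "(u, v) \<in> (adj ends F)\<^sup>*"
  obtains p where "walk ends F u p v" "distinct (u # map snd p)"
proof -
  from assms have "\<exists>p. walk ends F u p v \<and> distinct (u # map snd p)"
  proof (induction rule: converse_rtrancl_induct)
    case base
    show ?case by (rule exI[of _ "[]"]) simp
  next
    case (step u y)
    then obtain h p where h: "h \<in> F" "ends h = Upair u y"
      and p: "walk ends F y p v" "distinct (y # map snd p)" by (auto simp: adj_def)
    show ?case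
    proof (cases "u \<in> set (y # map snd p)")
      case True
      with p show ?thesis by (rule_tac walk_suffix)
    next
      case False
      with h p show ?thesis by (intro exI[of _ "(h, y) # p"]) auto
    qed
  qed
  with that show thesis by blast
qed

text \<open>The edge of the first step ends at \<open>u\<close>, and a path does not visit
  \<open>u\<close> again, so this edge cannot recur.\<close>

lemma path_distinct_edges:
  "walk ends F u p v \<Longrightarrow> distinct (u # map snd p) \<Longrightarrow> distinct (map fst p)"
proof (induction ends F u p v rule: walk.induct)
  case (2 ends F u e x p v)
  have "e \<notin> fst ` set p"
  proof
    assume "e \<in> fst ` set p"
    then have "set_uprod (ends e) \<subseteq> set (x # map snd p)" using 2 by (intro walk_ends) auto
    with 2 show False by auto
  qed
  with 2 show ?case by auto
qed simp

text \<open>Removing an edge from a cycle leaves a walk between its ends, and an edge closes any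
  path that avoids it. Acyclicity thus becomes independence in the cycle matroid. A loop is closed
  by the empty path.\<close>

lemma acyclic_iff:
  "(\<nexists>u p. mg_cycle ends T u p) \<longleftrightarrow> (\<forall>h\<in>T. \<not> spans ends (T - {h}) h)"
proof (intro iffI ballI notI)
  fix h assume acyc: "\<nexists>u p. mg_cycle ends T u p" and h: "h \<in> T" "spans ends (T - {h}) h"
  obtain u x where ux: "ends h = Upair u x" by (cases "ends h")
  then have "(x, u) \<in> (adj ends (T - {h}))\<^sup>*"
    using h spans_Upair[of ends h u x] adj_rtrancl_sym by fast
  then obtain p where p: "walk ends (T - {h}) x p u" "distinct (x # map snd p)"
    by (rule path_exists)
  have "h \<notin> fst ` set p" using walk_edges[OF p(1)] by auto
  moreover have "walk ends T x p u" using walk_mono[OF p(1)] walk_edges[OF p(1)] by blast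
  \<comment> \<open>A walk records the vertices it reaches, so the cycle lists \<open>x\<close>
    followed by the vertices of \<open>p\<close>, and these are distinct by the choice of
    \<open>p\<close>.\<close>
  ultimately have "mg_cycle ends T u ((h, x) # p)"
    using p path_distinct_edges[OF p] ux h by (auto simp: mg_cycle_def)
  with acyc show False by blast
next
  assume indep: "\<forall>h\<in>T. \<not> spans ends (T - {h}) h" and "\<exists>u p. mg_cycle ends T u p"
  then obtain u p where "mg_cycle ends T u p" by blast
  then obtain h x q where h: "p = (h, x) # q" "h \<in> T" "ends h = Upair u x" "walk ends T x q u"
    "h \<notin> fst ` set q" by (cases p) (auto simp: mg_cycle_def)
  then have "walk ends (T - {h}) x q u"
    by (rule_tac walk_mono[OF h(4)]) (use walk_edges[OF h(4)] h(5) in auto)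
  then have "(u, x) \<in> (adj ends (T - {h}))\<^sup>*"
    by (rule adj_rtrancl_sym[OF walk_imp_adj_rtrancl])
  then show False using h indep spans_Upair[of ends h u x] by blast
qed

lemma mg_connected_adj:
  "mg_connected V F ends \<longleftrightarrow> V \<noteq> {} \<and> (\<forall>u\<in>V. \<forall>v\<in>V. (u, v) \<in> (adj ends F)\<^sup>*)"
proof -
  have "(\<exists>p. walk ends F u p v) \<longleftrightarrow> (u, v) \<in> (adj ends F)\<^sup>*" for u v
    by (auto intro: walk_imp_adj_rtrancl elim: path_exists)
  then show ?thesis by (simp add: mg_connected_def)
qed

section \<open>Minimum spanning trees for distinct weights\<close>

text \<open>Spanning trees are the bases of the cycle matroid. As the whole graph is connected,
  connecting \<open>V\<close> amounts to spanning every edge of \<open>E\<close>.\<close>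

lemma (in finite_multigraph) spanning_tree_iff:
  assumes "mg_connected V E ends"
  shows "spanning_tree V E ends T \<longleftrightarrow>
    T \<subseteq> E \<and> (\<forall>h\<in>E. spans ends T h) \<and> (\<forall>h\<in>T. \<not> spans ends (T - {h}) h)"
proof -
  have "mg_connected V T ends \<longleftrightarrow> (\<forall>h\<in>E. spans ends T h)"
  proof
    assume *: "mg_connected V T ends"
    show "\<forall>h\<in>E. spans ends T h"
    proof
      fix h assume "h \<in> E"
      obtain u v where uv: "ends h = Upair u v" by (cases "ends h")
      with ends_in_verts[OF \<open>h \<in> E\<close>] have "u \<in> V" "v \<in> V" by auto
      with * uv show "spans ends T h" by (simp add: spans_Upair[of ends h, OF uv] mg_connected_adj)
    qed
  next
    assume "\<forall>h\<in>E. spans ends T h"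
    then show "mg_connected V T ends"
      using assms adj_rtrancl_spans[of _ _ ends E T] unfolding mg_connected_adj by blast
  qed
  then show ?thesis unfolding spanning_tree_def acyclic_iff by simp
qed

text \<open>Basis exchange. The new set spans \<open>f\<close> and hence all that \<open>T\<close>
  spans. It is independent because \<open>e\<close> is not spanned by \<open>T - {f}\<close>, while
  a dependent \<open>h\<close> could be exchanged with \<open>e\<close> to give such a
  spanning.\<close>

lemma (in finite_multigraph) spanning_tree_swap:
  assumes conn: "mg_connected V E ends" and T: "spanning_tree V E ends T"
    and f: "f \<in> T" and e: "e \<in> E" and sp: "spans ends (insert e (T - {f})) f"
  shows "spanning_tree V E ends (insert e (T - {f}))"
proof -
  let ?T = "insert e (T - {f})"
  have sub: "T \<subseteq> E" and all: "\<And>h. h \<in> E \<Longrightarrow> spans ends T h"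
    and ind: "\<And>h. h \<in> T \<Longrightarrow> \<not> spans ends (T - {h}) h"
    using T by (auto simp: spanning_tree_iff[OF conn])
  have "spans ends ?T k" if "k \<in> T" for k
    using that sp by (cases "k = f") (auto intro: spans_self)
  then have span: "\<forall>h\<in>E. spans ends ?T h" using all spans_trans[of ends T _ ?T] by blast
  have e': "\<not> spans ends (T - {f}) e"
  proof
    assume "spans ends (T - {f}) e"
    then have "spans ends (T - {f}) f"
      by (intro spans_trans[OF sp]) (auto intro: spans_self)
    with ind f show False by blast
  qed
  have "\<not> spans ends (?T - {h}) h" if h: "h \<in> ?T" for h
  proof
    assume *: "spans ends (?T - {h}) h"
    show False
    proof (cases "h = e")
      case True
      have "?T - {h} \<subseteq> T - {f}" using True by auto
      then have "spans ends (T - {f}) e" using * True spans_mono by fast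
      with e' show False ..
    next
      case False
      then have hT: "h \<in> T" "h \<noteq> f" and eq: "?T - {h} = insert e (T - {f} - {h})" using h by auto
      have "\<not> spans ends (T - {f} - {h}) h"
        using ind[OF hT(1)] spans_mono[of "T - {f} - {h}" "T - {h}" ends h] by auto
      then have "spans ends (insert h (T - {f} - {h})) e" 
        using * unfolding eq by (rule_tac spans_exchange)
      moreover have "insert h (T - {f} - {h}) = T - {f}" using hT by auto
      ultimately show False using e' by simp
    qed
  qed
  with span sub e show ?thesis by (auto simp: spanning_tree_iff[OF conn])
qed

lemma sum_swap_less:
  fixes w :: "'e \<Rightarrow> real"
  assumes "finite T" "f \<in> T" "e \<notin> T" "w e < w f"
  shows "sum w (insert e (T - {f})) < sum w T"
  using assms by (simp add: sum.remove[of T f w])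

text \<open>Each violation permits a swap that lowers the weight. If lighter edges span
  \<open>e\<close> in \<open>T\<close>, one of them is not spanned by \<open>T - {e}\<close> and can
  replace \<open>e\<close>. If they do not span an \<open>e\<close> outside \<open>T\<close>, the
  tree path between its ends has a heavier edge, which \<open>e\<close> can replace.\<close>

lemma (in finite_multigraph) mst_iff:
  assumes conn: "mg_connected V E ends" and inj: "inj_on w E" and T: "is_mst V E ends w T"
    and e: "e \<in> E"
  shows "e \<in> T \<longleftrightarrow> \<not> spans ends {h\<in>E. w h < w e} e"
proof -
  have tree: "spanning_tree V E ends T"
    and min: "\<And>T'. spanning_tree V E ends T' \<Longrightarrow> sum w T \<le> sum w T'"
    using T by (auto simp: is_mst_def)
  have sub: "T \<subseteq> E" and all: "\<And>h. h \<in> E \<Longrightarrow> spans ends T h"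
    and ind: "\<And>h. h \<in> T \<Longrightarrow> \<not> spans ends (T - {h}) h"
    using tree by (auto simp: spanning_tree_iff[OF conn])
  have fin: "finite T" using sub finite_edges by (rule finite_subset)
  have no_swap: False
    if "f \<in> T" "h \<in> E" "h \<notin> T" "w h < w f" "spans ends (insert h (T - {f})) f" for f h
    using min[OF spanning_tree_swap[OF conn tree that(1,2,5)]]
      sum_swap_less[OF fin that(1,3,4)] by simp
  show ?thesis
  proof (intro iffI notI)
    assume eT: "e \<in> T" and sp: "spans ends {h\<in>E. w h < w e} e"
    obtain f where f: "f \<in> E" "w f < w e" "\<not> spans ends (T - {e}) f"
      using spans_trans[OF sp, of "T - {e}"] ind[OF eT] by auto
    have "f \<notin> T"
      using f spans_self[of f "T - {e}" ends] by auto
    moreover have "spans ends (insert f (T - {e})) e"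
      using all[OF f(1)] f(3) eT by (rule_tac spans_exchange) (auto simp: insert_absorb)
    ultimately show False using no_swap[OF eT f(1)] f(2) by blast
  next
    assume nsp: "\<not> spans ends {h\<in>E. w h < w e} e"
    show "e \<in> T"
    proof (rule ccontr)
      assume eT: "e \<notin> T"
      \<comment> \<open>A minimal member is the tree path between the ends of \<open>e\<close>; by
        minimality each of its edges can be exchanged with \<open>e\<close>.\<close>
      define \<S> where "\<S> = {S. S \<subseteq> T \<and> spans ends S e}"
      have "finite \<S>" "\<S> \<noteq> {}" using fin all[OF e] by (auto simp: \<S>_def)
      then obtain S where S: "S \<in> \<S>" and Smin: "\<And>S'. S' \<in> \<S> \<Longrightarrow> S' \<subseteq> S \<Longrightarrow> S' = S"
        using finite_has_minimal[of \<S>] by blast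
      have "\<not> S \<subseteq> {h\<in>E. w h < w e}"
        using nsp S spans_mono[of S _ ends e] by (auto simp: \<S>_def)
      then obtain f where f: "f \<in> S" "f \<in> E" "\<not> w f < w e" using S sub by (auto simp: \<S>_def)
      have fT: "f \<in> T" using f S by (auto simp: \<S>_def)
      then have "w f \<noteq> w e" using inj f e eT by (auto dest: inj_onD)
      with f have less: "w e < w f" by simp
      have "\<not> spans ends (S - {f}) e"
        using Smin[of "S - {f}"] f S by (auto simp: \<S>_def)
      moreover have "spans ends (insert f (S - {f})) e"
        using S f by (simp add: \<S>_def insert_absorb)
      ultimately have "spans ends (insert e (S - {f})) f" by (rule_tac spans_exchange)
      moreover have "insert e (S - {f}) \<subseteq> insert e (T - {f})" using S by (auto simp: \<S>_def)
      ultimately have "spans ends (insert e (T - {f})) f" using spans_mono by fast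
      then show False using no_swap[OF fT e eT less] by blast
    qed
  qed
qed

text \<open>A minimal spanning subset of \<open>E\<close> is a spanning tree, and finitely many
  trees have a lightest one.\<close>

lemma (in finite_multigraph) mst_exists:
  assumes conn: "mg_connected V E ends"
  shows "\<exists>T. is_mst V E ends w T"
proof -
  define \<S> where "\<S> = {S. S \<subseteq> E \<and> (\<forall>h\<in>E. spans ends S h)}"
  have "finite \<S>" "\<S> \<noteq> {}" using finite_edges by (auto simp: \<S>_def intro: spans_self)
  then obtain S where S: "S \<in> \<S>" and Smin: "\<And>S'. S' \<in> \<S> \<Longrightarrow> S' \<subseteq> S \<Longrightarrow> S' = S"
    using finite_has_minimal[of \<S>] by blast
  have "\<not> spans ends (S - {h}) h" if h: "h \<in> S" for h
  proof
    assume *: "spans ends (S - {h}) h"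
    have "spans ends (S - {h}) k" if "k \<in> S" for k
      using that * by (cases "k = h") (auto intro: spans_self)
    then have "S - {h} \<in> \<S>"
      using S spans_trans[of ends S _ "S - {h}"] by (auto simp: \<S>_def)
    with Smin[of "S - {h}"] h show False by auto
  qed
  then have "spanning_tree V E ends S" using S by (auto simp: \<S>_def spanning_tree_iff[OF conn])
  moreover have "finite {T. spanning_tree V E ends T}"
    using finite_edges by (rule_tac finite_subset[of _ "Pow E"]) (auto simp: spanning_tree_def)
  ultimately obtain T where "spanning_tree V E ends T"
    "\<And>T'. spanning_tree V E ends T' \<Longrightarrow> sum w T \<le> sum w T'"
    using ex_is_arg_min_if_finite[of "{T. spanning_tree V E ends T}" "sum w"]
    by (auto simp: is_arg_min_linorder)
  then show ?thesis by (auto simp: is_mst_def)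
qed

text \<open>By \<open>mst_iff\<close> the weights alone determine the members of any minimum
  spanning tree, which gives the uniqueness that \<open>THE\<close> asks for.\<close>

lemma (in finite_multigraph) random_mst_eq:
  assumes conn: "mg_connected V E ends" and inj: "inj_on (\<lambda>h. W h \<omega>) E"
  shows "random_mst V E ends W \<omega> = {e\<in>E. \<not> spans ends {h\<in>E. W h \<omega> < W e \<omega>} e}"
proof -
  let ?w = "\<lambda>h. W h \<omega>"
  have eq: "T = {e\<in>E. \<not> spans ends {h\<in>E. ?w h < ?w e} e}" if "is_mst V E ends ?w T" for T
    using mst_iff[OF conn inj that] that by (auto simp: is_mst_def spanning_tree_def)
  obtain T where T: "is_mst V E ends ?w T" using mst_exists[OF conn] by blast
  have "random_mst V E ends W \<omega> = T"
    unfolding random_mst_def by (rule the_equality[where P = "is_mst V E ends ?w", OF T]) (use eq T in blast)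
  with eq[OF T] show ?thesis by simp
qed

section \<open>Predicates of the order of the weights\<close>

text \<open>A random subset of a finite set takes finitely many values, so an arbitrary predicate of
  it is a finite union of measurable events.\<close>

lemma sets_finite_Collect_pred:
  assumes "finite A" and "\<And>\<omega>. X \<omega> \<subseteq> A"
    and "\<And>x. x \<in> A \<Longrightarrow> {\<omega>\<in>space M. x \<in> X \<omega>} \<in> sets M"
  shows "{\<omega>\<in>space M. \<Phi> (X \<omega>)} \<in> sets M"
proof -
  have "{\<omega>\<in>space M. \<Phi> (X \<omega>)}
    = {\<omega>\<in>space M. \<exists>B\<in>{B\<in>Pow A. \<Phi> B}. \<forall>x\<in>A. x \<in> X \<omega> \<longleftrightarrow> x \<in> B}"
    using assms(2) by (auto intro: equalityI) (metis (no_types, lifting) Collect_mem_eq Collect_cong subsetD)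
  also have "\<dots> \<in> sets M"
  proof (intro sets.sets_Collect_finite_Ex sets.sets_Collect_finite_All)
    fix x B assume "x \<in> A"
    then show "{\<omega>\<in>space M. x \<in> X \<omega> \<longleftrightarrow> x \<in> B} \<in> sets M"
      using assms(3) by (cases "x \<in> B") (auto intro: sets.sets_Collect_neg)
  qed (use assms(1) in auto)
  finally show ?thesis .
qed

definition order_rel :: "'e set \<Rightarrow> ('e \<Rightarrow> real) \<Rightarrow> ('e \<times> 'e) set" where
  "order_rel A w = {(h, k). h \<in> A \<and> k \<in> A \<and> w h < w k}"

text \<open>For finite \<open>A\<close> such a predicate depends on one of finitely many order
  patterns, ties included, which makes its event measurable.\<close>

definition order_pred :: "'e set \<Rightarrow> (('e \<Rightarrow> real) \<Rightarrow> bool) \<Rightarrow> bool" where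
  "order_pred A P \<longleftrightarrow> (\<forall>w w'. order_rel A w = order_rel A w' \<longrightarrow> P w = P w')"

lemma order_predD: "order_pred A P \<Longrightarrow> order_rel A w = order_rel A w' \<Longrightarrow> P w \<longleftrightarrow> P w'"
  unfolding order_pred_def by blast

lemma order_pred_const: "order_pred A (\<lambda>_. c)"
  by (simp add: order_pred_def)

lemma order_pred_conj: "order_pred A P \<Longrightarrow> order_pred A Q \<Longrightarrow> order_pred A (\<lambda>w. P w \<and> Q w)"
  unfolding order_pred_def by blast

lemma order_pred_mono:
  assumes "order_pred A P" "A \<subseteq> B"
  shows "order_pred B P"
proof -
  have "order_rel A w = order_rel B w \<inter> A \<times> A" for w
    using assms(2) by (auto simp: order_rel_def)
  then have "order_rel A w = order_rel A w'" if "order_rel B w = order_rel B w'" for w w'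
    using that by simp
  then show ?thesis using order_predD[OF assms(1)] unfolding order_pred_def by blast
qed

lemma order_pred_less: "h \<in> A \<Longrightarrow> k \<in> A \<Longrightarrow> order_pred A (\<lambda>w. w h < w k)"
  by (auto simp: order_pred_def order_rel_def set_eq_iff)

lemma order_pred_ball:
  "(\<And>x. x \<in> S \<Longrightarrow> order_pred A (P x)) \<Longrightarrow> order_pred A (\<lambda>w. \<forall>x\<in>S. P x w)"
  unfolding order_pred_def by blast

lemma order_pred_Collect_less:
  assumes "B \<subseteq> A" "k \<in> A"
  shows "order_pred A (\<lambda>w. \<Phi> {h\<in>B. w h < w k})"
proof -
  have "{h\<in>B. w h < w k} = {h\<in>B. w' h < w' k}" if "order_rel A w = order_rel A w'" for w w' :: "'a \<Rightarrow> real"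
    using assms that by (auto simp: order_rel_def set_eq_iff)
  then show ?thesis
    unfolding order_pred_def by (intro allI impI arg_cong[where f = \<Phi>])
qed

lemma order_pred_measurable:
  assumes A: "finite A" and P: "order_pred A P" and X: "\<And>h. h \<in> A \<Longrightarrow> X h \<in> borel_measurable M"
  shows "{\<omega>\<in>space M. P (\<lambda>h. X h \<omega>)} \<in> sets M"
proof -
  let ?O = "\<lambda>\<omega>. order_rel A (\<lambda>h. X h \<omega>)"
  have "P w \<longleftrightarrow> (\<exists>w'. order_rel A w' = order_rel A w \<and> P w')" for w
    using order_predD[OF P] by blast
  then have "{\<omega>\<in>space M. P (\<lambda>h. X h \<omega>)} = {\<omega>\<in>space M. (\<lambda>B. \<exists>w'. order_rel A w' = B \<and> P w') (?O \<omega>)}"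
    by blast
  also have "\<dots> \<in> sets M"
  proof (rule sets_finite_Collect_pred[where A = "A \<times> A"])
    fix x assume "x \<in> A \<times> A"
    then obtain h k where x: "x = (h, k)" and hk: "h \<in> A" "k \<in> A" by blast
    have "{\<omega>\<in>space M. X h \<omega> < X k \<omega>} \<in> sets M"
      using X[OF hk(1)] X[OF hk(2)] by measurable
    then show "{\<omega>\<in>space M. x \<in> ?O \<omega>} \<in> sets M" using hk by (simp add: x order_rel_def)
  qed (use A in \<open>auto simp: order_rel_def\<close>)
  finally show ?thesis .
qed

section \<open>Ranks and permutations that match two orders\<close>

lemma card_order_bij:
  fixes w :: "'e \<Rightarrow> real"
  assumes "finite R" and "inj_on w R"
  defines "r \<equiv> \<lambda>h. card {k\<in>R. w k < w h}"
  shows "bij_betw r R {..<card R}" and "\<And>h k. h \<in> R \<Longrightarrow> k \<in> R \<Longrightarrow> r h < r k \<longleftrightarrow> w h < w k"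
proof -
  have less: "r h < r k" if "h \<in> R" "w h < w k" for h k
    unfolding r_def using that assms(1) by (intro psubset_card_mono) auto
  show iff: "r h < r k \<longleftrightarrow> w h < w k" if "h \<in> R" "k \<in> R" for h k
    using that
  proof (cases "w h" "w k" rule: linorder_cases)
    case equal
    then have "h = k" using that inj_onD[OF assms(2)] by blast
    then show ?thesis by simp
  qed (use less[of h k] less[of k h] that in auto)
  have inj: "inj_on r R"
  proof (rule inj_onI)
    fix h k assume "h \<in> R" "k \<in> R" "r h = r k"
    then have "w h = w k" using iff[of h k] iff[of k h] by auto
    then show "h = k" using \<open>h \<in> R\<close> \<open>k \<in> R\<close> inj_onD[OF assms(2)] by blast
  qed
  have "r h < card R" if "h \<in> R" for h
    unfolding r_def using that assms(1) by (intro psubset_card_mono) auto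
  then have "r ` R \<subseteq> {..<card R}" by auto
  then have "r ` R = {..<card R}"
    by (intro card_subset_eq) (simp_all add: card_image[OF inj])
  with inj show "bij_betw r R {..<card R}" by (simp add: bij_betw_def)
qed

text \<open>\<open>\<sigma>\<close> sends the element of a given rank under \<open>w\<close> to the
  element of the same rank under \<open>w'\<close>.\<close>

lemma order_matching_permutation:
  fixes w w' :: "'e \<Rightarrow> real"
  assumes "finite R" "inj_on w R" "inj_on w' R"
  obtains \<sigma> where "\<sigma> permutes R" "order_rel R (w' \<circ> \<sigma>) = order_rel R w"
proof -
  let ?r = "\<lambda>h. card {k\<in>R. w k < w h}" and ?r' = "\<lambda>h. card {k\<in>R. w' k < w' h}"
  note r = card_order_bij[OF assms(1,2)] and r' = card_order_bij[OF assms(1,3)]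
  define \<tau> where "\<tau> = inv_into R ?r' \<circ> ?r"
  define \<sigma> where "\<sigma> h = (if h \<in> R then \<tau> h else h)" for h
  have bij: "bij_betw \<tau> R R"
    unfolding \<tau>_def using r(1) bij_betw_inv_into[OF r'(1)] by (rule bij_betw_trans)
  then have "bij_betw \<sigma> R R" by (simp add: \<sigma>_def cong: bij_betw_cong)
  then have "\<sigma> permutes R" by (rule bij_imp_permutes) (simp add: \<sigma>_def)
  moreover have "\<tau> h \<in> R" "?r' (\<tau> h) = ?r h" if "h \<in> R" for h
    using bij_betwE[OF bij] that bij_betw_inv_into_right[OF r'(1), of "?r h"] bij_betwE[OF r(1)]
    by (auto simp: \<tau>_def)
  then have "w' (\<tau> h) < w' (\<tau> k) \<longleftrightarrow> w h < w k" if "h \<in> R" "k \<in> R" for h k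
    using r(2)[of h k] r'(2)[of "\<tau> h" "\<tau> k"] that by simp
  then have "order_rel R (w' \<circ> \<sigma>) = order_rel R w" by (auto simp: order_rel_def \<sigma>_def)
  ultimately show thesis by (rule that)
qed

section \<open>Exchangeability of the weights\<close>

context iid_weighted_multigraph
begin

lemma W_measurable [measurable]: "h \<in> E \<Longrightarrow> W h \<in> borel_measurable M"
  using indep by (auto simp: indep_vars_def)

lemmas order_pred_sets = order_pred_measurable[OF finite_edges _ W_measurable]

text \<open>The value of \<open>THE\<close> depends only on the comparisons between the finitely
  many sums over subsets of \<open>E\<close>. This covers also the outcomes where it is
  unspecified.\<close>

lemma random_mst_measurable: "{\<omega>\<in>space M. \<Phi> (random_mst V E ends W \<omega>)} \<in> sets M"
proof -
  let ?s = "\<lambda>\<omega> T. \<Sum>e\<in>T. W e \<omega>"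
  let ?X = "\<lambda>\<omega>. {(T, T'). T \<subseteq> E \<and> T' \<subseteq> E \<and> ?s \<omega> T \<le> ?s \<omega> T'}"
  define \<Psi> where "\<Psi> A = \<Phi> (THE T. spanning_tree V E ends T \<and> (\<forall>T'. spanning_tree V E ends T' \<longrightarrow> (T, T') \<in> A))"
    for A
  have "is_mst V E ends (\<lambda>e. W e \<omega>) T \<longleftrightarrow>
      spanning_tree V E ends T \<and> (\<forall>T'. spanning_tree V E ends T' \<longrightarrow> (T, T') \<in> ?X \<omega>)" for \<omega> T
    by (auto simp: is_mst_def spanning_tree_def)
  then have "{\<omega>\<in>space M. \<Phi> (random_mst V E ends W \<omega>)} = {\<omega>\<in>space M. \<Psi> (?X \<omega>)}"
    by (simp add: random_mst_def \<Psi>_def)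
  also have "\<dots> \<in> sets M"
  proof (rule sets_finite_Collect_pred[where A = "Pow E \<times> Pow E"])
    fix x assume "x \<in> Pow E \<times> Pow E"
    then obtain T T' where x: "x = (T, T')" and sub: "T \<subseteq> E" "T' \<subseteq> E" by blast
    have [measurable]: "(\<lambda>\<omega>. ?s \<omega> T) \<in> borel_measurable M" "(\<lambda>\<omega>. ?s \<omega> T') \<in> borel_measurable M"
      using sub by (auto intro!: borel_measurable_sum W_measurable)
    have "{\<omega>\<in>space M. ?s \<omega> T \<le> ?s \<omega> T'} \<in> sets M" by measurable
    then show "{\<omega>\<in>space M. x \<in> ?X \<omega>} \<in> sets M" using sub by (simp add: x)
  qed (use finite_edges in auto)
  finally show ?thesis .
qed

text \<open>The joint law is \<open>L \<Otimes>\<^sub>M L\<close>, and each section of the diagonal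
  is a single point, hence null; Fubini gives the claim.\<close>

lemma AE_W_neq:
  assumes "i \<in> E" "j \<in> E" "i \<noteq> j"
  shows "AE \<omega> in M. W i \<omega> \<noteq> W j \<omega>"
proof -
  have "indep_var borel ((\<lambda>x. x i) \<circ> (\<lambda>\<omega>. restrict (\<lambda>k. W k \<omega>) {i}))
      borel ((\<lambda>x. x j) \<circ> (\<lambda>\<omega>. restrict (\<lambda>k. W k \<omega>) {j}))"
    using assms by (intro indep_var_compose[OF indep_var_restrict[OF indep, of "{i}" "{j}"]]) auto
  then have "indep_var borel (W i) borel (W j)" by (simp add: comp_def)
  then have joint: "distr M (borel \<Otimes>\<^sub>M borel) (\<lambda>x. (W i x, W j x)) = L \<Otimes>\<^sub>M L"
    using law assms by (simp add: indep_var_distribution_eq)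
  have L: "sets L = sets borel" "prob_space L"
    using law[OF assms(1)] prob_space_distr[OF W_measurable[OF assms(1)]] by auto
  interpret L: prob_space L by (rule L(2))
  interpret LL: pair_prob_space L L ..
  have [measurable]: "W i \<in> borel_measurable M" "W j \<in> borel_measurable M"
    using assms by auto
  have L0: "emeasure L {x} = 0" for x
    using atomless by (simp add: L.emeasure_eq_measure)
  have "AE y in L. x \<noteq> y" for x
    by (rule AE_I'[of "{x}"]) (auto simp: null_sets_def L0 L(1))
  moreover have "{z\<in>space (L \<Otimes>\<^sub>M L). fst z \<noteq> snd z} \<in> sets (L \<Otimes>\<^sub>M L)"
  proof -
    note [measurable_cong] = L(1)
    show ?thesis by measurable
  qed
  ultimately have "AE z in L \<Otimes>\<^sub>M L. fst z \<noteq> snd z"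
    by (intro LL.AE_pair_measure) auto
  then have "AE z in distr M (borel \<Otimes>\<^sub>M borel) (\<lambda>x. (W i x, W j x)). fst z \<noteq> snd z"
    unfolding joint .
  then show ?thesis by (subst (asm) AE_distr_iff) auto
qed

lemma AE_W_inj: "AE \<omega> in M. inj_on (\<lambda>h. W h \<omega>) E"
proof -
  have "AE \<omega> in M. \<forall>i\<in>E. \<forall>j\<in>E. i \<noteq> j \<longrightarrow> W i \<omega> \<noteq> W j \<omega>"
    using finite_edges AE_W_neq by (auto simp: AE_finite_all)
  then show ?thesis by eventually_elim (auto simp: inj_on_def)
qed

text \<open>The joint law of the weights is a power of \<open>L\<close> and hence invariant under
  permuting the coordinates.\<close>

lemma exchangeable:
  assumes \<pi>: "\<pi> permutes E" and P: "order_pred E P"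
  shows "\<P>(\<omega> in M. P (\<lambda>h. W (\<pi> h) \<omega>)) = \<P>(\<omega> in M. P (\<lambda>h. W h \<omega>))"
\<comment> \<open>Independence is expressed by a product law over a nonempty index set; for empty
  \<open>E\<close> the permutation is the identity.\<close>
proof (cases "E = {}")
  case False
  let ?B = "\<Pi>\<^sub>M i\<in>E. (borel :: real measure)"
  let ?N = "\<Pi>\<^sub>M i\<in>E. L"
  have \<pi>E: "\<pi> h \<in> E" if "h \<in> E" for h using that permutes_in_image[OF \<pi>] by simp
  have N: "distr M ?B (\<lambda>x. \<lambda>i\<in>E. W i x) = ?N"
    using indep indep_vars_iff_distr_eq_PiM'[where I = E and X = W and M' = "\<lambda>_. borel"] False law
    by (simp cong: PiM_cong)
  have L: "prob_space L" "sets L = sets borel"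
  proof -
    from False obtain h where "h \<in> E" by blast
    then show "prob_space L" "sets L = sets borel"
      using law[of h] prob_space_distr[OF W_measurable[of h]] by auto
  qed
  have N': "distr M ?B (\<lambda>x. \<lambda>i\<in>E. W (\<pi> i) x) = ?N"
  proof -
    have [measurable]: "(\<lambda>\<omega>. \<lambda>n\<in>E. \<omega> (\<pi> n)) \<in> measurable ?B ?B"
      by (rule measurable_restrict) (use \<pi>E in measurable)
    have [measurable]: "(\<lambda>x. \<lambda>i\<in>E. W i x) \<in> measurable M ?B"
      by (rule measurable_restrict) simp
    have "distr ?N ?B (\<lambda>\<omega>. \<lambda>n\<in>E. \<omega> (\<pi> n)) = distr ?N ?N (\<lambda>\<omega>. \<lambda>n\<in>E. \<omega> (\<pi> n))"
      using L(2) by (intro distr_cong) (auto intro!: sets_PiM_cong)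
    also have "\<dots> = ?N"
      using distr_PiM_reindex[of E "\<lambda>_. L" \<pi> E] L(1) \<pi>E permutes_inj_on[OF \<pi>] by auto
    finally show ?thesis
      unfolding N[symmetric] by (subst (asm) distr_distr) (auto simp: comp_def \<pi>E cong: restrict_cong)
  qed
  let ?P = "{w\<in>space ?B. P w}"
  have Pset: "?P \<in> sets ?B"
    using order_pred_measurable[OF finite_edges P, of "\<lambda>h w. w h" ?B] by simp
  \<comment> \<open>Points of the product space are \<open>undefined\<close> outside
    \<open>E\<close>, where \<open>P\<close> does not look.\<close>
  have restr: "P (\<lambda>i\<in>E. w i) \<longleftrightarrow> P w" for w
    by (rule order_predD[OF P]) (auto simp: order_rel_def)
  have "measure (distr M ?B (\<lambda>x. \<lambda>i\<in>E. W (\<rho> i) x)) ?P = \<P>(\<omega> in M. P (\<lambda>h. W (\<rho> h) \<omega>))"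
    if "\<rho> = id \<or> \<rho> = \<pi>" for \<rho>
  proof (subst measure_distr[OF _ Pset])
    show "(\<lambda>x. \<lambda>i\<in>E. W (\<rho> i) x) \<in> measurable M ?B"
      by (rule measurable_restrict) (use that \<pi>E in auto)
    show "prob ((\<lambda>x. \<lambda>i\<in>E. W (\<rho> i) x) -` ?P \<inter> space M) = \<P>(\<omega> in M. P (\<lambda>h. W (\<rho> h) \<omega>))"
      by (rule arg_cong[where f = prob]) (auto simp: space_PiM restr)
  qed
  from this[of id] this[of \<pi>] show ?thesis by (simp add: N N')
qed (use \<pi> in simp)

text \<open>
  The number of permutations \<open>\<pi>\<close> of \<open>R\<close> for which \<open>Q (w \<circ> \<pi>)\<close> holds is the same for all \<open>w\<close>
  without ties, so averaging over \<open>\<pi>\<close> factors \<open>Q\<close> out of any event invariant under all \<open>\<pi>\<close>.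
\<close>

lemma indep_order_on_subset:
  assumes R: "R \<subseteq> E" and P: "order_pred E P" and Q: "order_pred R Q"
    and inv: "\<And>\<pi> w. \<pi> permutes R \<Longrightarrow> P (w \<circ> \<pi>) \<longleftrightarrow> P w"
  shows "\<P>(\<omega> in M. P (\<lambda>h. W h \<omega>) \<and> Q (\<lambda>h. W h \<omega>))
    = \<P>(\<omega> in M. P (\<lambda>h. W h \<omega>)) * \<P>(\<omega> in M. Q (\<lambda>h. W h \<omega>))"
proof -
  let ?w = "\<lambda>\<omega> h. W h \<omega>"
  define S where "S = {\<pi>. \<pi> permutes R}"
  have finR: "finite R" using R finite_edges by (rule finite_subset)
  have finS: "finite S" unfolding S_def using finR by (rule finite_permutations)
  have SE: "\<pi> permutes E" if "\<pi> \<in> S" for \<pi> using that R by (auto simp: S_def intro: permutes_subset)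
  have "id \<in> S" by (simp add: S_def permutes_id)
  then have cS: "card S > 0" using finS by (auto simp: card_gt_0_iff)
  define c where "c w = card {\<pi>\<in>S. Q (w \<circ> \<pi>)}" for w
  \<comment> \<open>Composition with the order matching \<open>\<sigma>\<close> carries the
    permutations counted for \<open>w\<close> bijectively to those counted for
    \<open>w'\<close>.\<close>
  have c_eq: "c w = c w'" if w: "inj_on w R" "inj_on w' R" for w w'
  proof -
    obtain \<sigma> where \<sigma>: "\<sigma> permutes R" "order_rel R (w' \<circ> \<sigma>) = order_rel R w"
      using order_matching_permutation[OF finR w] by blast
    have "Q (w' \<circ> (\<sigma> \<circ> \<pi>)) \<longleftrightarrow> Q (w \<circ> \<pi>)" if "\<pi> \<in> S" for \<pi>
    proof (rule order_predD[OF Q])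
      have "\<pi> h \<in> R \<longleftrightarrow> h \<in> R" for h using that by (simp add: S_def permutes_in_image)
      then show "order_rel R (w' \<circ> (\<sigma> \<circ> \<pi>)) = order_rel R (w \<circ> \<pi>)"
        using \<sigma>(2) by (auto simp: order_rel_def set_eq_iff)
    qed
    moreover have "\<sigma> \<circ> \<pi> \<in> S" "inv \<sigma> \<circ> \<pi> \<in> S" if "\<pi> \<in> S" for \<pi>
      using that \<sigma>(1) by (simp_all add: S_def permutes_compose permutes_inv)
    moreover have "\<sigma> \<circ> (inv \<sigma> \<circ> \<pi>) = \<pi>" "inv \<sigma> \<circ> (\<sigma> \<circ> \<pi>) = \<pi>" for \<pi>
      using permutes_inv_o[OF \<sigma>(1)] by (simp_all add: comp_assoc[symmetric])
    ultimately have "bij_betw (\<lambda>\<pi>. \<sigma> \<circ> \<pi>) {\<pi>\<in>S. Q (w \<circ> \<pi>)} {\<pi>\<in>S. Q (w' \<circ> \<pi>)}"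
      by (intro bij_betw_byWitness[where f' = "\<lambda>\<pi>. inv \<sigma> \<circ> \<pi>"]) (force simp del: o_apply)+
    then show ?thesis unfolding c_def by (rule bij_betw_same_card)
  qed
  define c0 where "c0 = c (SOME w. inj_on w R)"
  have c0: "c w = c0" if "inj_on w R" for w
    unfolding c0_def using that by (intro c_eq someI[where P = "\<lambda>w. inj_on w R"])
  \<comment> \<open>Kept general in \<open>P'\<close>: the constant \<open>True\<close> identifies
    \<open>c0 / card S\<close> as the probability of \<open>Q\<close>, and then \<open>P\<close>
    gives the claim.\<close>
  have main: "real (card S) * \<P>(\<omega> in M. P' (?w \<omega>) \<and> Q (?w \<omega>)) = real c0 * \<P>(\<omega> in M. P' (?w \<omega>))"
    if P': "order_pred E P'" and inv': "\<And>\<pi> w. \<pi> permutes R \<Longrightarrow> P' (w \<circ> \<pi>) \<longleftrightarrow> P' w" for P'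
  proof -
    have PQ: "order_pred E (\<lambda>w. P' w \<and> Q w)" by (rule order_pred_conj[OF P' order_pred_mono[OF Q R]])
    let ?A = "{\<omega>\<in>space M. P' (?w \<omega>)}" and ?B = "\<lambda>\<pi>. {\<omega>\<in>space M. P' (?w \<omega>) \<and> Q (?w \<omega> \<circ> \<pi>)}"
    have PQ': "order_pred E (\<lambda>w. P' w \<and> Q (w \<circ> \<pi>))" if "\<pi> \<in> S" for \<pi>
    proof -
      have "P' w \<and> Q (w \<circ> \<pi>) \<longleftrightarrow> P' w' \<and> Q (w' \<circ> \<pi>)" if "order_rel E w = order_rel E w'" for w w'
      proof -
        have "order_rel E (w \<circ> \<pi>) = order_rel E (w' \<circ> \<pi>)"
          using that permutes_in_image[OF SE[OF \<open>\<pi> \<in> S\<close>]] by (auto simp: order_rel_def set_eq_iff)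
        then show ?thesis
          using order_predD[OF P' that] order_predD[OF order_pred_mono[OF Q R]] by blast
      qed
      then show ?thesis unfolding order_pred_def by blast
    qed
    have m: "?B \<pi> \<in> sets M" if "\<pi> \<in> S" for \<pi>
      using order_pred_sets[OF PQ'[OF that]] .
    have mA: "?A \<in> sets M" using order_pred_sets[OF P'] .
    \<comment> \<open>By exchangeability, since \<open>P'\<close> does not change under
      \<open>\<pi>\<close>. The sum of these probabilities is the expected number of good
      permutations, which is \<open>c0\<close> on \<open>?A\<close> when there are no ties.\<close>
    have "prob (?B \<pi>) = prob (?B id)" if "\<pi> \<in> S" for \<pi>
    proof -
      have "P' (\<lambda>h. W (\<pi> h) \<omega>) \<longleftrightarrow> P' (?w \<omega>)" for \<omega>
        using inv'[of \<pi> "?w \<omega>"] that by (simp add: S_def comp_def)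
      with exchangeable[OF SE[OF that] PQ] show ?thesis by (simp add: comp_def)
    qed
    then have "real (card S) * prob (?B id) = (\<Sum>\<pi>\<in>S. prob (?B \<pi>))" by simp
    also have "\<dots> = (\<Sum>\<pi>\<in>S. \<integral>\<omega>. indicator (?B \<pi>) \<omega> \<partial>M)" using m by (intro sum.cong) auto
    also have "\<dots> = (\<integral>\<omega>. (\<Sum>\<pi>\<in>S. indicator (?B \<pi>) \<omega>) \<partial>M)"
      using m by (subst Bochner_Integration.integral_sum) (auto intro!: integrable_real_indicator simp: emeasure_eq_measure)
    also have "\<dots> = (\<integral>\<omega>. real c0 * indicator ?A \<omega> \<partial>M)"
    proof (rule integral_cong_AE)
      show "AE \<omega> in M. (\<Sum>\<pi>\<in>S. indicator (?B \<pi>) \<omega>) = real c0 * indicator ?A \<omega>"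
        using AE_W_inj
      proof (eventually_elim)
        case (elim \<omega>)
        then have "inj_on (?w \<omega>) R" using R by (rule inj_on_subset)
        then have "real (card {\<pi>\<in>S. Q (?w \<omega> \<circ> \<pi>)}) = real c0" using c0 by (simp add: c_def)
        then have "(\<Sum>\<pi>\<in>S. of_bool (Q (?w \<omega> \<circ> \<pi>))) = real c0"
          using finS by (simp add: sum_of_bool_eq Int_def)
        moreover have "indicator (?B \<pi>) \<omega> = indicator ?A \<omega> * (of_bool (Q (?w \<omega> \<circ> \<pi>)) :: real)" for \<pi>
          by (auto simp: indicator_def)
        ultimately show ?case by (simp add: sum_distrib_left[symmetric] mult.commute[of "real c0"])
      qed
    qed (use m mA in \<open>auto intro!: borel_measurable_sum\<close>)
    also have "\<dots> = real c0 * prob ?A" using mA by simp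
    finally show ?thesis by (simp add: comp_def)
  qed
  have "real c0 = real (card S) * \<P>(\<omega> in M. Q (?w \<omega>))"
    using main[OF order_pred_const[of E True]] by (simp add: prob_space)
  with main[OF P inv] have "real (card S) * \<P>(\<omega> in M. P (?w \<omega>) \<and> Q (?w \<omega>))
      = real (card S) * (\<P>(\<omega> in M. P (?w \<omega>)) * \<P>(\<omega> in M. Q (?w \<omega>)))"
    by (simp add: mult_ac)
  with cS show ?thesis by simp
qed

end

section \<open>Joint membership in the tree\<close>

context iid_weighted_multigraph
begin

lemma AE_mem_random_mst:
  "AE \<omega> in M. \<forall>e\<in>E. e \<in> random_mst V E ends W \<omega> \<longleftrightarrow> \<not> spans ends {h\<in>E. W h \<omega> < W e \<omega>} e"
  using AE_W_inj by eventually_elim (simp add: random_mst_eq[OF connected])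

lemma order_pred_not_spanned:
  "e \<in> E \<Longrightarrow> order_pred E (\<lambda>w. \<not> spans ends {h\<in>E. w h < w e} e)"
  by (rule order_pred_Collect_less[where \<Phi> = "\<lambda>A. \<not> spans ends A e"]) auto

lemma prob_mem_random_mst:
  assumes "e \<in> E"
  shows "\<P>(\<omega> in M. e \<in> random_mst V E ends W \<omega>)
    = \<P>(\<omega> in M. \<not> spans ends {h\<in>E. W h \<omega> < W e \<omega>} e)"
proof (rule finite_measure_eq_AE)
  show "AE \<omega> in M. \<omega> \<in> {\<omega>\<in>space M. e \<in> random_mst V E ends W \<omega>} \<longleftrightarrow>
      \<omega> \<in> {\<omega>\<in>space M. \<not> spans ends {h\<in>E. W h \<omega> < W e \<omega>} e}"
    using AE_mem_random_mst by eventually_elim (use assms in auto)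
qed (rule random_mst_measurable order_pred_sets[OF order_pred_not_spanned[OF assms]])+

text \<open>The event is split by the value \<open>S\<close> of the set of edges lighter than
  \<open>e\<close>. Each \<open>before S\<close> is invariant under permutations of
  \<open>R S\<close>, and \<open>after S\<close> depends only on the order within
  \<open>R S\<close>, so the two are independent.\<close>

lemma prob_mst_pair_ordered:
  assumes e: "e \<in> E" and f: "f \<in> E" and "e \<noteq> f"
  shows "\<P>(\<omega> in M. e \<in> random_mst V E ends W \<omega> \<and> f \<in> random_mst V E ends W \<omega> \<and> W e \<omega> < W f \<omega>)
    \<le> \<P>(\<omega> in M. e \<in> random_mst V E ends W \<omega>) * \<P>(\<omega> in M. f \<in> random_mst V E ends W \<omega>)"
    (is "prob ?LHS \<le> ?pe * ?pf")
proof -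
  let ?w = "\<lambda>\<omega> h. W h \<omega>"
  define H where "H = E - {e, f}"
  define R where "R S = insert f (H - S)" for S
  define before where "before S w \<longleftrightarrow> (\<forall>h\<in>S. w h < w e) \<and> (\<forall>h\<in>R S. w e < w h)"
    for S and w :: "'e \<Rightarrow> real"
  \<comment> \<open>All of \<open>S\<close> is adjoined, wherever its weights lie relative to that
    of \<open>f\<close>; this keeps the event a function of the order on \<open>R S\<close>.\<close>
  define after where "after S w \<longleftrightarrow> \<not> spans ends (insert e (S \<union> {h\<in>R S. w h < w f})) f"
    for S and w :: "'e \<Rightarrow> real"
  define \<S> where "\<S> = {S. S \<subseteq> H \<and> \<not> spans ends S e}"
  let ?A = "\<lambda>S. {\<omega>\<in>space M. before S (?w \<omega>)}"
  let ?AB = "\<lambda>S. {\<omega>\<in>space M. before S (?w \<omega>) \<and> after S (?w \<omega>)}"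
  have fin: "finite \<S>"
    using finite_edges by (intro finite_subset[of \<S> "Pow E"]) (auto simp: \<S>_def H_def)
  have RE: "R S \<subseteq> E" for S using f by (auto simp: R_def H_def)
  have before: "order_pred E (before S)" if "S \<in> \<S>" for S
    unfolding before_def using that RE[of S] e
    by (intro order_pred_conj order_pred_ball order_pred_less) (auto simp: \<S>_def H_def)
  have after: "order_pred (R S) (after S)" for S
    unfolding after_def
    by (rule order_pred_Collect_less[where \<Phi> = "\<lambda>A. \<not> spans ends (insert e (S \<union> A)) f"])
      (auto simp: R_def)
  have mA: "?A S \<in> sets M" if "S \<in> \<S>" for S by (rule order_pred_sets[OF before[OF that]])
  have mB: "{\<omega>\<in>space M. after S (?w \<omega>)} \<in> sets M" for S
    by (rule order_pred_sets[OF order_pred_mono[OF after RE]])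
  have mAB: "?AB S \<in> sets M" if "S \<in> \<S>" for S
    using sets.Int[OF mA[OF that] mB[of S]] by (simp add: Collect_conj_eq Int_ac)
  have indep: "prob (?AB S) = prob (?A S) * \<P>(\<omega> in M. after S (?w \<omega>))" if S: "S \<in> \<S>" for S
  proof (rule indep_order_on_subset[OF RE before[OF S] after])
    fix \<pi> and w :: "'e \<Rightarrow> real" assume \<pi>: "\<pi> permutes R S"
    have fix_S: "\<pi> h = h" if "h \<in> insert e S" for h
      using that S \<open>e \<noteq> f\<close> by (intro permutes_not_in[OF \<pi>]) (auto simp: R_def \<S>_def H_def)
    have "(\<forall>h\<in>R S. w e < w (\<pi> h)) \<longleftrightarrow> (\<forall>h\<in>\<pi> ` R S. w e < w h)" by simp
    then show "before S (w \<circ> \<pi>) \<longleftrightarrow> before S w"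
      using fix_S by (simp add: before_def permutes_image[OF \<pi>])
  qed
  \<comment> \<open>Every edge lighter than \<open>f\<close> is \<open>e\<close> or lies in
    \<open>S\<close> or in \<open>R S\<close>, so the set tested by \<open>after S\<close> contains
    all edges lighter than \<open>f\<close>.\<close>
  have after_le: "\<P>(\<omega> in M. after S (?w \<omega>)) \<le> ?pf" for S
    unfolding prob_mem_random_mst[OF f]
  proof (rule finite_measure_mono)
    have "spans ends (insert e (S \<union> {h\<in>R S. W h \<omega> < W f \<omega>})) f"
      if "spans ends {h\<in>E. W h \<omega> < W f \<omega>} f" for \<omega>
      by (rule spans_mono[OF _ that]) (auto simp: R_def H_def)
    then show "{\<omega>\<in>space M. after S (?w \<omega>)} \<subseteq> {\<omega>\<in>space M. \<not> spans ends {h\<in>E. ?w \<omega> h < ?w \<omega> f} f}"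
      unfolding after_def by blast
  qed (rule order_pred_sets[OF order_pred_not_spanned[OF f]])
  \<comment> \<open>As \<open>before S\<close> determines \<open>S\<close>, the events are disjoint,
    and since \<open>S\<close> does not span \<open>e\<close>, each of them puts \<open>e\<close> in
    the tree almost surely.\<close>
  have lighter: "{h\<in>E. w h < w e} = S" if "S \<in> \<S>" "before S w" for S w
  proof (intro set_eqI iffI)
    fix h assume h: "h \<in> {h\<in>E. w h < w e}"
    then have "h \<notin> R S" "h \<noteq> e" using that(2) by (auto simp: before_def dest: less_asym)
    with h show "h \<in> S" by (auto simp: R_def H_def)
  qed (use that in \<open>auto simp: \<S>_def H_def before_def\<close>)
  have "prob ?LHS \<le> prob (\<Union>S\<in>\<S>. ?AB S)"
  proof (rule finite_measure_mono_AE)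
    show "AE \<omega> in M. \<omega> \<in> ?LHS \<longrightarrow> \<omega> \<in> (\<Union>S\<in>\<S>. ?AB S)"
      using AE_mem_random_mst AE_W_inj
    proof eventually_elim
      case (elim \<omega>)
      show ?case
      proof
        assume \<omega>: "\<omega> \<in> ?LHS"
        define S where "S = {h\<in>E. W h \<omega> < W e \<omega>}"
        have less: "W e \<omega> < W f \<omega>" using \<omega> by simp
        then have "S \<subseteq> H" by (auto simp: S_def H_def)
        moreover have "\<not> spans ends S e" using \<omega> elim(1) e by (auto simp: S_def)
        moreover have "before S (?w \<omega>)"
        proof -
          \<comment> \<open>Not being lighter than \<open>e\<close> means being strictly heavier
            only because ties are excluded.\<close>
          have "W e \<omega> < W h \<omega>" if h: "h \<in> H" "h \<notin> S" for h
          proof -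
            have "W e \<omega> \<noteq> W h \<omega>" using inj_onD[OF elim(2), of e h] h e by (auto simp: H_def)
            then show ?thesis using h by (auto simp: S_def H_def)
          qed
          then show ?thesis using less by (auto simp: before_def R_def S_def)
        qed
        moreover have "after S (?w \<omega>)"
        proof -
          have "\<not> spans ends {h\<in>E. W h \<omega> < W f \<omega>} f" using \<omega> elim(1) f by auto
          moreover have "insert e (S \<union> {h\<in>R S. W h \<omega> < W f \<omega>}) \<subseteq> {h\<in>E. W h \<omega> < W f \<omega>}"
            using less e RE[of S] by (auto simp: S_def)
          ultimately show ?thesis unfolding after_def using spans_mono by fast
        qed
        ultimately show "\<omega> \<in> (\<Union>S\<in>\<S>. ?AB S)" using \<omega> by (auto simp: \<S>_def)
      qed
    qed
  qed (use fin mAB in auto)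
  also have "\<dots> \<le> (\<Sum>S\<in>\<S>. prob (?AB S))"
    using fin mAB by (intro finite_measure_subadditive_finite) auto
  also have "\<dots> \<le> (\<Sum>S\<in>\<S>. prob (?A S) * ?pf)"
    using after_le by (intro sum_mono) (simp add: indep mult_left_mono)
  also have "\<dots> = prob (\<Union>S\<in>\<S>. ?A S) * ?pf"
  proof -
    have "disjoint_family_on ?A \<S>" unfolding disjoint_family_on_def using lighter by blast
    then show ?thesis
      using fin mA by (subst finite_measure_finite_Union) (auto simp: sum_distrib_right)
  qed
  also have "\<dots> \<le> ?pe * ?pf"
  proof (rule mult_right_mono)
    have "\<not> spans ends {h\<in>E. W h \<omega> < W e \<omega>} e" if "S \<in> \<S>" "before S (?w \<omega>)" for S \<omega>
      using lighter[OF that] that(1) by (simp add: \<S>_def)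
    then show "prob (\<Union>S\<in>\<S>. ?A S) \<le> ?pe"
      unfolding prob_mem_random_mst[OF e]
      by (intro finite_measure_mono order_pred_sets[OF order_pred_not_spanned[OF e]]) blast
  qed simp
  finally show ?thesis .
qed

theorem prob_mst_pair:
  assumes e: "e \<in> E" and f: "f \<in> E" and "e \<noteq> f"
  shows "\<P>(\<omega> in M. e \<in> random_mst V E ends W \<omega> \<and> f \<in> random_mst V E ends W \<omega>)
    \<le> 2 * \<P>(\<omega> in M. e \<in> random_mst V E ends W \<omega>) * \<P>(\<omega> in M. f \<in> random_mst V E ends W \<omega>)"
    (is "prob ?L \<le> 2 * ?pe * ?pf")
proof -
  let ?T = "random_mst V E ends W"
  let ?A = "\<lambda>e f. {\<omega>\<in>space M. e \<in> ?T \<omega> \<and> f \<in> ?T \<omega> \<and> W e \<omega> < W f \<omega>}"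
  have m: "?A e f \<in> sets M" if "e \<in> E" "f \<in> E" for e f
  proof -
    have [simp]: "e \<in> E" "f \<in> E" by fact+
    have "{\<omega>\<in>space M. W e \<omega> < W f \<omega>} \<in> sets M" by measurable
    from sets.Int[OF random_mst_measurable[of "\<lambda>T. e \<in> T \<and> f \<in> T"] this]
    show ?thesis by (simp add: Collect_conj_eq Int_ac)
  qed
  have "prob ?L \<le> prob (?A e f \<union> ?A f e)"
  proof (rule finite_measure_mono_AE)
    show "AE \<omega> in M. \<omega> \<in> ?L \<longrightarrow> \<omega> \<in> ?A e f \<union> ?A f e"
      using AE_W_neq[OF assms] by eventually_elim auto
  qed (use m e f in auto)
  also have "\<dots> \<le> prob (?A e f) + prob (?A f e)"
    using m e f by (intro measure_Un_le) auto
  also have "\<dots> \<le> ?pe * ?pf + ?pf * ?pe"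
    using assms by (intro add_mono prob_mst_pair_ordered) auto
  finally show ?thesis by simp
qed

end

section \<open>The function \<open>g\<close> and the final bounds\<close>

text \<open>The difference of \<open>(1 - 2 * p)\<^sup>2\<close> and \<open>1 - 4 * p\<close> is the
  square \<open>4 * p\<^sup>2\<close>. Equivalently, \<open>g p\<close> is a root of
  \<open>x * (1 - x) = p\<close> in the unit interval.\<close>

lemma g_ge:
  assumes "0 \<le> p" "p \<le> 1/4"
  shows "p \<le> g p"
proof -
  have "sqrt (1 - 4 * p) \<le> sqrt ((1 - 2 * p)\<^sup>2)"
    by (rule real_sqrt_le_mono) (simp add: power2_eq_square algebra_simps)
  also have "\<dots> = 1 - 2 * p" using assms by simp
  finally show ?thesis by (simp add: g_def)
qed

lemma g_ratio_tendsto: "((\<lambda>p. g p / p) \<longlongrightarrow> 1) (at_right 0)"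
  unfolding g_def by real_asymp

text \<open>The limit is taken along the product filter, so that \<open>p\<close> and
  \<open>q\<close> may tend to 0 independently of each other.\<close>

lemma g_ratio_pair:
  assumes "\<epsilon> > 0"
  shows "\<exists>\<delta>>0. \<forall>p q. 0 < p \<and> 0 < q \<and> max p q < \<delta> \<longrightarrow> \<bar>2 * (g p / p) * (g q / q) - 2\<bar> < \<epsilon>"
proof -
  have "((\<lambda>x. 2 * (g (fst x) / fst x) * (g (snd x) / snd x)) \<longlongrightarrow> 2 * 1 * 1) (at_right 0 \<times>\<^sub>F at_right 0)"
    by (intro tendsto_intros filterlim_compose[OF g_ratio_tendsto] filterlim_fst filterlim_snd)
  then have "\<forall>\<^sub>F x in at_right 0 \<times>\<^sub>F at_right 0. \<bar>2 * (g (fst x) / fst x) * (g (snd x) / snd x) - 2\<bar> < \<epsilon>"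
    using assms by (auto simp: tendsto_iff dist_real_def)
  then obtain P Q where "eventually P (at_right 0)" "eventually Q (at_right 0)"
    and PQ: "\<And>p q. P p \<Longrightarrow> Q q \<Longrightarrow> \<bar>2 * (g p / p) * (g q / q) - 2\<bar> < \<epsilon>"
    by (auto simp: eventually_prod_filter)
  \<comment> \<open>Both conditions are imposed on one variable to obtain a single
    \<open>\<delta>\<close> for \<open>p\<close> and \<open>q\<close>.\<close>
  then have "\<forall>\<^sub>F p in at_right 0. P p \<and> Q p" by (auto intro: eventually_conj)
  then obtain \<delta> where "\<delta> > 0" "\<And>p. 0 < p \<Longrightarrow> p < \<delta> \<Longrightarrow> P p \<and> Q p"
    by (auto simp: eventually_at_right_field)
  with PQ show ?thesis by (intro exI[of _ \<delta>]) auto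
qed

theorem corollary3p5:
  fixes V :: "'v set" and E :: "'e set" and ends :: "'e \<Rightarrow> 'v uprod"
    and M :: "'w measure" and L :: "real measure" and W :: "'e \<Rightarrow> 'w \<Rightarrow> real" and e f :: 'e
  assumes "iid_weighted_multigraph V E ends M L W"
    and "e \<in> E" and "f \<in> E" and "e \<noteq> f"
  shows
    "(let T = random_mst V E ends W;
          p\<^sub>e = \<P>(\<omega> in M. e \<in> T \<omega>);
          p\<^sub>f = \<P>(\<omega> in M. f \<in> T \<omega>);
          p\<^sub>e\<^sub>f = \<P>(\<omega> in M. e \<in> T \<omega> \<and> f \<in> T \<omega>)
      in p\<^sub>e \<le> 1/4 \<and> p\<^sub>f \<le> 1/4 \<longrightarrow>
           p\<^sub>e\<^sub>f \<le> 2 * g p\<^sub>e * g p\<^sub>f \<and>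
           (p\<^sub>e * p\<^sub>f > 0 \<longrightarrow> p\<^sub>e\<^sub>f / (p\<^sub>e * p\<^sub>f) \<le> 2 * (g p\<^sub>e / p\<^sub>e) * (g p\<^sub>f / p\<^sub>f)))
     \<and>
     (\<forall>\<epsilon>>0. \<exists>\<delta>>0.
        (\<forall>p q. 0 < p \<and> 0 < q \<and> max p q < \<delta> \<longrightarrow>
           \<bar>2 * (g p / p) * (g q / q) - 2\<bar> < \<epsilon>) \<and>
        (\<forall>(V :: 'v set) (E :: 'e set) (ends :: 'e \<Rightarrow> 'v uprod)
           (M :: 'w measure) (L :: real measure) (W :: 'e \<Rightarrow> 'w \<Rightarrow> real) e f.
           iid_weighted_multigraph V E ends M L W \<and> e \<in> E \<and> f \<in> E \<and> e \<noteq> f \<longrightarrow>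
           (let T = random_mst V E ends W;
                p\<^sub>e = \<P>(\<omega> in M. e \<in> T \<omega>);
                p\<^sub>f = \<P>(\<omega> in M. f \<in> T \<omega>);
                p\<^sub>e\<^sub>f = \<P>(\<omega> in M. e \<in> T \<omega> \<and> f \<in> T \<omega>)
            in p\<^sub>e * p\<^sub>f > 0 \<and> max p\<^sub>e p\<^sub>f < \<delta> \<longrightarrow>
                 p\<^sub>e\<^sub>f / (p\<^sub>e * p\<^sub>f) \<le> 2 + \<epsilon>)))"
proof -
  have bound: "a \<le> 2 * g p * g q \<and> (p * q > 0 \<longrightarrow> a / (p * q) \<le> 2 * (g p / p) * (g q / q))"
    if a: "a \<le> 2 * p * q" and pq: "0 \<le> p" "0 \<le> q" "p \<le> 1/4" "q \<le> 1/4" for a p q :: real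
  proof -
    have "p * q \<le> g p * g q"
      using g_ge[of p] g_ge[of q] pq by (intro mult_mono) auto
    with a have "a \<le> 2 * g p * g q" by simp
    then show ?thesis by (simp add: divide_right_mono)
  qed
  \<comment> \<open>The estimate of \<open>prob_mst_pair\<close> bounds the quotient directly by 2,
    without passing through \<open>g\<close>.\<close>
  have ratio: "a / (p * q) \<le> 2 + \<epsilon>" if "a \<le> 2 * p * q" "p * q > 0" "\<epsilon> > 0" for a p q \<epsilon> :: real
  proof -
    have "a / (p * q) \<le> 2" using that by (simp add: divide_le_eq mult.assoc)
    with that show ?thesis by simp
  qed
  show ?thesis
    unfolding Let_def
  proof (intro conjI[rotated] allI impI)
    fix \<epsilon> :: real assume "\<epsilon> > 0"
    then obtain \<delta> where "\<delta> > 0"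
      "\<forall>p q. 0 < p \<and> 0 < q \<and> max p q < \<delta> \<longrightarrow> \<bar>2 * (g p / p) * (g q / q) - 2\<bar> < \<epsilon>"
      using g_ratio_pair by blast
    then show "\<exists>\<delta>>0.
        (\<forall>p q. 0 < p \<and> 0 < q \<and> max p q < \<delta> \<longrightarrow>
           \<bar>2 * (g p / p) * (g q / q) - 2\<bar> < \<epsilon>) \<and>
        (\<forall>(V :: 'v set) (E :: 'e set) (ends :: 'e \<Rightarrow> 'v uprod)
           (M :: 'w measure) (L :: real measure) (W :: 'e \<Rightarrow> 'w \<Rightarrow> real) e f.
           iid_weighted_multigraph V E ends M L W \<and> e \<in> E \<and> f \<in> E \<and> e \<noteq> f \<longrightarrow>
           \<P>(\<omega> in M. e \<in> random_mst V E ends W \<omega>) * \<P>(\<omega> in M. f \<in> random_mst V E ends W \<omega>) > 0 \<and>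
           max \<P>(\<omega> in M. e \<in> random_mst V E ends W \<omega>) \<P>(\<omega> in M. f \<in> random_mst V E ends W \<omega>) < \<delta> \<longrightarrow>
           \<P>(\<omega> in M. e \<in> random_mst V E ends W \<omega> \<and> f \<in> random_mst V E ends W \<omega>) /
             (\<P>(\<omega> in M. e \<in> random_mst V E ends W \<omega>) * \<P>(\<omega> in M. f \<in> random_mst V E ends W \<omega>))
             \<le> 2 + \<epsilon>)"
      using ratio[OF iid_weighted_multigraph.prob_mst_pair _ \<open>\<epsilon> > 0\<close>]
      by (intro exI[of _ \<delta>]) auto
  qed (use bound[OF iid_weighted_multigraph.prob_mst_pair[OF assms]] in auto)
qed

end
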